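(* Let $q$ be a prime power, $n\ge 1$, and $0\le N<q-1$ an integer. Let $Q\subset\mathbb{R}^n$ be a lattice polytope with $\dim Q\geq 1$ such that the dilates $kQ$, for all integers $0\leq k\leq N$, are contained in $K_q^n=[0,q-2]^n$. Let $\mathcal{P}(Q)\subset\mathbb{R}^{n+1}$ be the unit pyramid over $Q$. Then for every integer $0\le k\le N$ the minimum distances of the toric codes over $\mathbb{F}_q$ satisfy $$d(\mathcal{C}_{k\mathcal{P}(Q)})=(q-1)\,d(\mathcal{C}_{kQ}).$$
   Context: A lattice polytope in $\mathbb{R}^n$ is the convex hull of a finite nonempty subset of $\mathbb{Z}^n$. For a prime power $q$, put $K_q^n=[0,q-2]^n\subset\mathbb{R}^n$. For a lattice polytope $P\subseteq K_q^n$, let $\mathcal{L}(P)$ be the $\mathbb{F}_q$-vector space of polynomials spanned by the monomials $x^m=x_1^{m_1}\cdots x_n^{m_n}$ with $m=(m_1,\dots,m_n)\in P\cap\mathbb{Z}^n$. The toric code $\mathcal{C}_P$ is the linear code of block length $(q-1)^n$ over $\mathbb{F}_q$ consisting of the vectors $(f(\xi))_{\xi\in(\mathbb{F}_q^* )^n}$ for $f\in\mathcal{L}(P)$. Its minimum distance $d(\mathcal{C}_P)$ is the minimum weight (number of nonzero coordinates) of a nonzero codeword. Equivalently, it is $d(\mathcal{C}_P)=(q-1)^n-\max_{0\ne f\in\mathcal{L}(P)}Z(f)$, where $Z(f)$ is the number of points of $(\mathbb{F}_q^* )^n$ at which $f$ vanishes. The $k$-dilate is $kQ=\{kx\mid x\in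 Q\}$ (so $0Q=\{0\}$). The unit pyramid over $Q\subset\mathbb{R}^n$ is $\mathcal{P}(Q)=\operatorname{conv}\big(\{e_{n+1}\}\cup\{(x,0)\mid x\in Q\}\big)\subset\mathbb{R}^{n+1}$, where $e_{n+1}=(0,\dots,0,1)$; under the hypotheses of the claim, $k\mathcal{P}(Q)\subseteq K_q^{n+1}$ for $0\le k\le N$. *)

theory Defs
  imports "HOL-Analysis.Analysis" "HOL-Library.Poly_Mapping"
begin

section \<open>Lattice polytopes\<close>

definition lattice :: "(real ^ 'n) set" where
  "lattice = {x. \<forall>i. x $ i \<in> \<int>}"

definition lattice_polytope :: "(real ^ 'n) set \<Rightarrow> bool" where
  "lattice_polytope P \<longleftrightarrow>
     (\<exists>S. finite S \<and> S \<noteq> {} \<and> S \<subseteq> lattice \<and> P = convex hull S)"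

definition K_cube :: "nat \<Rightarrow> (real ^ 'n) set" where
  "K_cube q = {x. \<forall>i. 0 \<le> x $ i \<and> x $ i \<le> real q - 2}"

definition dilate :: "nat \<Rightarrow> (real ^ 'n) set \<Rightarrow> (real ^ 'n) set" where
  "dilate k Q = (\<lambda>x. real k *\<^sub>R x) ` Q"

text \<open>
  If \<open>'n\<close> indexes the coordinates of \<open>n\<close>-space, then \<open>'n option\<close> indexes those of
  \<open>(n+1)\<close>-space: \<open>Some i\<close> are the old coordinates and \<open>None\<close> is the new, last one.
\<close>

definition embed0 :: "real ^ 'n \<Rightarrow> real ^ ('n option)" where
  "embed0 x = (\<chi> i. case i of None \<Rightarrow> 0 | Some j \<Rightarrow> x $ j)"

definition unit_pyramid :: "(real ^ 'n) set \<Rightarrow> (real ^ ('n option)) set" where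
  "unit_pyramid Q = convex hull (insert (axis None 1) (embed0 ` Q))"


section \<open>Polynomials\<close>

text \<open>
  A polynomial is a finitely supported map from exponent vectors to coefficients.
\<close>

type_synonym ('a, 'n) mpoly = "('n \<Rightarrow>\<^sub>0 nat) \<Rightarrow>\<^sub>0 'a"

definition mpoly_scale :: "'a::field \<Rightarrow> ('a, 'n) mpoly \<Rightarrow> ('a, 'n) mpoly" where
  "mpoly_scale c f = Poly_Mapping.map ((*) c) f"

definition monomial :: "('n \<Rightarrow>\<^sub>0 nat) \<Rightarrow> ('a::field, 'n) mpoly" where
  "monomial m = Poly_Mapping.single m 1"

definition mpoly_eval :: "('a::field, 'n::finite) mpoly \<Rightarrow> 'a ^ 'n \<Rightarrow> 'a" where
  "mpoly_eval f \<xi> =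
     (\<Sum>m\<in>Poly_Mapping.keys f.
        Poly_Mapping.lookup f m * (\<Prod>i\<in>UNIV. (\<xi> $ i) ^ Poly_Mapping.lookup m i))"

lemma lookup_mpoly_scale [simp]:
  "Poly_Mapping.lookup (mpoly_scale c f) m = c * Poly_Mapping.lookup f m"
  by (simp add: mpoly_scale_def Poly_Mapping.map.rep_eq when_def)

lemma vector_space_mpoly: "vector_space mpoly_scale"
  by unfold_locales (auto intro!: poly_mapping_eqI simp: lookup_add algebra_simps)

text \<open>
  Exponents are natural numbers, so lattice points with a negative coordinate contribute
  nothing; for \<open>P \<subseteq> K_cube q\<close> there are none.
\<close>

definition L_space :: "(real ^ 'n) set \<Rightarrow> ('a::field, 'n::finite) mpoly set" where
  "L_space P =
     module.span mpoly_scale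
       {monomial m | m. (\<chi> i. real (Poly_Mapping.lookup m i)) \<in> P}"


section \<open>Codes\<close>

text \<open>
  A word with coordinates indexed by a finite set \<open>I\<close> is a function restricted to \<open>I\<close>.
\<close>

definition hamming_weight :: "'i set \<Rightarrow> ('i \<Rightarrow> 'a::zero) \<Rightarrow> nat" where
  "hamming_weight I c = card {i \<in> I. c i \<noteq> 0}"

definition min_distance :: "'i set \<Rightarrow> ('i \<Rightarrow> 'a::zero) set \<Rightarrow> nat" where
  "min_distance I C = Min {hamming_weight I c | c. c \<in> C \<and> (\<exists>i\<in>I. c i \<noteq> 0)}"

definition torus :: "('a::field ^ 'n) set" where
  "torus = {\<xi>. \<forall>i. \<xi> $ i \<noteq> 0}"

definition toric_code :: "(real ^ 'n) set \<Rightarrow> ('a::field ^ 'n::finite \<Rightarrow> 'a) set" where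
  "toric_code P = {restrict (mpoly_eval f) torus | f. f \<in> L_space P}"

text \<open>The field is passed as a type argument, since the polytope does not determine it.\<close>

definition toric_min_distance :: "'a::{field,finite} itself \<Rightarrow> (real ^ 'n::finite) set \<Rightarrow> nat" where
  "toric_min_distance _ P = min_distance torus (toric_code P :: ('a ^ 'n \<Rightarrow> 'a) set)"

end

theory Submission
  imports Defs "HOL-Computational_Algebra.Polynomial"
begin

text \<open>
  Write a polynomial of the pyramid code as \<open>f = \<Sum>\<^sub>j f\<^sub>j y\<^sup>j\<close> with \<open>f\<^sub>j\<close> supported in \<open>(k - j)Q\<close>. If
  \<open>f\<^sub>j\<close> is the top nonzero coefficient, then above each point where \<open>f\<^sub>j\<close> does not vanish \<open>f\<close> has
  at most \<open>j\<close> zeros, so \<open>f\<close> has weight at least \<open>(q - 1 - j) w(f\<^sub>j)\<close>. Pick lattice points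
  \<open>a \<noteq> b\<close> of \<open>Q\<close>. The values of \<open>x\<^sup>a / x\<^sup>b\<close> partition the support of \<open>f\<^sub>j\<close> into \<open>q - 1\<close> classes;
  multiplying \<open>f\<^sub>j\<close> by \<open>x\<^sup>a - c x\<^sup>b\<close> for the \<open>j\<close> heaviest classes \<open>c\<close> yields a polynomial supported in
  \<open>kQ\<close> of weight at most \<open>(q - 1 - j) w(f\<^sub>j) / (q - 1)\<close>. It is a nonzero codeword because it is a
  nonzero polynomial with exponents in \<open>[0, q - 2]\<close>. Polynomials not involving \<open>y\<close> give
  the converse inequality.
\<close>

section \<open>Polynomials as functions on the torus\<close>

definition exponent :: "('n::finite \<Rightarrow>\<^sub>0 nat) \<Rightarrow> real ^ 'n" where
  "exponent m = (\<chi> i. real (Poly_Mapping.lookup m i))"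

definition monom_eval :: "('n::finite \<Rightarrow>\<^sub>0 nat) \<Rightarrow> 'a::field ^ 'n \<Rightarrow> 'a" where
  "monom_eval m \<xi> = (\<Prod>i\<in>UNIV. (\<xi> $ i) ^ Poly_Mapping.lookup m i)"

lemma exponent_nth [simp]: "exponent m $ i = real (Poly_Mapping.lookup m i)"
  by (simp add: exponent_def)

lemma exponent_add: "exponent (a + b) = exponent a + exponent b"
  by (simp add: exponent_def vec_eq_iff lookup_add)

lemma exponent_surj:
  assumes "x \<in> lattice" and "\<And>i. 0 \<le> x $ i"
  obtains m :: "'n::finite \<Rightarrow>\<^sub>0 nat" where "exponent m = (x :: real ^ 'n)"
proof
  have "real (nat \<lfloor>x $ i\<rfloor>) = x $ i" for i
    using assms by (auto simp: lattice_def elim!: allE[of _ i] Ints_cases)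
  then show "exponent (Abs_poly_mapping (\<lambda>i. nat \<lfloor>x $ i\<rfloor>)) = x"
    by (simp add: exponent_def vec_eq_iff)
qed

lemma monom_eval_add: "monom_eval (a + b) \<xi> = monom_eval a \<xi> * monom_eval b \<xi>"
  by (simp add: monom_eval_def lookup_add power_add prod.distrib)

lemma monom_eval_nonzero: "\<xi> \<in> torus \<Longrightarrow> monom_eval m \<xi> \<noteq> 0"
  by (simp add: monom_eval_def torus_def)

text \<open>Turns the span into a condition on supports, the form used from here on. The polynomials
  with allowed support are a subspace containing the generators, and each of them is the combination
  of its own monomials.\<close>

lemma mem_L_space_iff:
  "f \<in> L_space P \<longleftrightarrow> (\<forall>m\<in>Poly_Mapping.keys f. exponent m \<in> P)"
proof -
  interpret V: vector_space mpoly_scale by (rule vector_space_mpoly)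
  let ?G = "{monomial m | m. exponent m \<in> P}"
  have L: "L_space P = V.span ?G"
    by (simp add: L_space_def exponent_def)
  have "V.subspace {f. \<forall>m\<in>Poly_Mapping.keys f. exponent m \<in> P}"
    by (rule V.subspaceI) (use keys_add in \<open>fastforce simp: in_keys_iff lookup_add\<close>)+
  moreover have "?G \<subseteq> {f. \<forall>m\<in>Poly_Mapping.keys f. exponent m \<in> P}"
    by (auto simp: monomial_def)
  ultimately have "V.span ?G \<subseteq> {f. \<forall>m\<in>Poly_Mapping.keys f. exponent m \<in> P}"
    by (rule V.span_minimal[rotated])
  moreover have "f \<in> V.span ?G" if "\<forall>m\<in>Poly_Mapping.keys f. exponent m \<in> P"
  proof -
    have "f = (\<Sum>m\<in>Poly_Mapping.keys f. mpoly_scale (Poly_Mapping.lookup f m) (monomial m))"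
      by (rule poly_mapping_eqI)
         (auto simp: lookup_sum monomial_def lookup_single when_def in_keys_iff if_distrib
               cong: if_cong)
    also have "\<dots> \<in> V.span ?G"
      using that by (intro V.span_sum V.span_scale V.span_base) auto
    finally show ?thesis .
  qed
  ultimately show ?thesis unfolding L by auto
qed

text \<open>Lets several polynomials be evaluated over one common index set of exponents; the added
  terms have coefficient zero.\<close>

lemma mpoly_eval_superset:
  assumes "finite A" "Poly_Mapping.keys f \<subseteq> A"
  shows "mpoly_eval f \<xi> = (\<Sum>m\<in>A. Poly_Mapping.lookup f m * monom_eval m \<xi>)"
  unfolding mpoly_eval_def monom_eval_def
  using assms by (intro sum.mono_neutral_left) (auto simp: in_keys_iff)

lemma mpoly_eval_diff: "mpoly_eval (f - g) \<xi> = mpoly_eval f \<xi> - mpoly_eval g \<xi>"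
proof -
  let ?A = "Poly_Mapping.keys f \<union> Poly_Mapping.keys g"
  have "Poly_Mapping.keys (f - g) \<subseteq> ?A"
    by (auto simp: in_keys_iff lookup_minus)
  then show ?thesis
    by (simp add: mpoly_eval_superset[of ?A] lookup_minus left_diff_distrib sum_subtractf)
qed

lemma lookup_single_mult:
  fixes g :: "('a::field, 'n) mpoly"
  shows "Poly_Mapping.lookup (Poly_Mapping.single a c * g) (a + m) = c * Poly_Mapping.lookup g m"
  by (simp add: lookup_mult lookup_single when_mult)

lemma mpoly_eval_single_mult:
  "mpoly_eval (Poly_Mapping.single a c * g) \<xi> = c * monom_eval a \<xi> * mpoly_eval g \<xi>"
proof -
  let ?A = "(+) a ` Poly_Mapping.keys g"
  have "Poly_Mapping.keys (Poly_Mapping.single a c * g) \<subseteq> ?A"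
    using keys_mult[of "Poly_Mapping.single a c" g] by (auto split: if_splits)
  then have "mpoly_eval (Poly_Mapping.single a c * g) \<xi> =
      (\<Sum>m\<in>?A. Poly_Mapping.lookup (Poly_Mapping.single a c * g) m * monom_eval m \<xi>)"
    by (intro mpoly_eval_superset) auto
  also have "\<dots> = (\<Sum>m\<in>Poly_Mapping.keys g. c * Poly_Mapping.lookup g m * (monom_eval a \<xi> * monom_eval m \<xi>))"
    by (subst sum.reindex) (auto simp: lookup_single_mult monom_eval_add)
  also have "\<dots> = c * monom_eval a \<xi> * mpoly_eval g \<xi>"
    by (simp add: mpoly_eval_def monom_eval_def sum_distrib_left mult_ac)
  finally show ?thesis .
qed

text \<open>
  Choose a coordinate \<open>i\<close> with \<open>a\<^sub>i \<noteq> b\<^sub>i\<close>; the monomial of \<open>g\<close> of largest \<open>i\<close>-th exponent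
  cannot cancel.
\<close>
lemma binomial_mult_nonzero:
  fixes g :: "('a::field, 'n) mpoly"
  assumes "g \<noteq> 0" "a \<noteq> b" "c \<noteq> 0"
  shows "(Poly_Mapping.single a 1 - Poly_Mapping.single b c) * g \<noteq> 0"
proof
  assume "(Poly_Mapping.single a 1 - Poly_Mapping.single b c) * g = 0"
  then have eq: "Poly_Mapping.single a 1 * g = Poly_Mapping.single b c * g"
    by (simp add: left_diff_distrib)
  \<comment> \<open>Stated for arbitrary \<open>a\<close>, \<open>b\<close>, \<open>c\<close>,
    \<open>d\<close>, so that it serves whichever exponent is larger at \<open>i\<close>. Only the
    coefficient of the larger one has to be nonzero.\<close>
  have no: False
    if "Poly_Mapping.single a c * g = Poly_Mapping.single b d * g" "c \<noteq> 0"
      "Poly_Mapping.lookup a i > Poly_Mapping.lookup b i"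
    for a b :: "'n \<Rightarrow>\<^sub>0 nat" and c d :: 'a and i
  proof -
    define M where "M = Max ((\<lambda>m. Poly_Mapping.lookup m i) ` Poly_Mapping.keys g)"
    have ne: "Poly_Mapping.keys g \<noteq> {}" using \<open>g \<noteq> 0\<close> by simp
    then have "M \<in> (\<lambda>m. Poly_Mapping.lookup m i) ` Poly_Mapping.keys g"
      unfolding M_def by (intro Max_in) auto
    then obtain m where m: "m \<in> Poly_Mapping.keys g" "Poly_Mapping.lookup m i = M" by auto
    have "Poly_Mapping.lookup (Poly_Mapping.single a c * g) (a + m) \<noteq> 0"
      using m that(2) by (simp add: lookup_single_mult in_keys_iff)
    then have "a + m \<in> Poly_Mapping.keys (Poly_Mapping.single b d * g)"
      by (simp add: in_keys_iff that(1))
    then obtain m' where m': "m' \<in> Poly_Mapping.keys g" "a + m = b + m'"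
      using keys_mult[of "Poly_Mapping.single b d" g] by (auto split: if_splits)
    have "Poly_Mapping.lookup m' i \<le> M"
      unfolding M_def using m'(1) by (intro Max_ge) auto
    moreover have "Poly_Mapping.lookup a i + M = Poly_Mapping.lookup b i + Poly_Mapping.lookup m' i"
      using arg_cong[OF m'(2), of "\<lambda>p. Poly_Mapping.lookup p i"] m(2) by (simp add: lookup_add)
    ultimately show False using that(3) by linarith
  qed
  obtain i where "Poly_Mapping.lookup a i \<noteq> Poly_Mapping.lookup b i"
    using \<open>a \<noteq> b\<close> by (meson poly_mapping_eqI)
  then consider "Poly_Mapping.lookup a i > Poly_Mapping.lookup b i"
    | "Poly_Mapping.lookup b i > Poly_Mapping.lookup a i" by linarith
  then show False
    using no[OF eq] no[OF eq[symmetric] \<open>c \<noteq> 0\<close>] by cases auto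
qed


section \<open>Injectivity of evaluation on the cube\<close>

text \<open>The translation \<open>x + 1\<close> permutes the field, so summing over all
  \<open>x\<close> shows that the cardinality is zero in the field.\<close>

lemma of_nat_CARD_minus_1:
  "of_nat (CARD('a) - 1) = (-1 :: 'a::{field,finite})"
proof -
  have "(\<Sum>x\<in>UNIV. x + 1 :: 'a) = (\<Sum>x\<in>UNIV. x)"
    by (rule sum.reindex_bij_witness[of _ "\<lambda>x. x - 1" "\<lambda>x. x + 1"]) auto
  then have "of_nat CARD('a) = (0 :: 'a)"
    by (simp add: sum.distrib)
  moreover have "CARD('a) > 0" by simp
  ultimately show ?thesis by (simp add: of_nat_diff Suc_leI)
qed

text \<open>The polynomial \<open>t^k - 1\<close> has at most \<open>k\<close> roots, fewer than
  there are units, so some unit \<open>s\<close> has \<open>s^k\<close> different from 1.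
  Multiplication by \<open>s\<close> permutes the units and scales the sum by
  \<open>s^k\<close>.\<close>

lemma sum_power_units_eq_0:
  assumes "0 < k" "k < CARD('a::{field,finite}) - 1"
  shows "(\<Sum>t\<in>UNIV - {0 :: 'a}. t ^ k) = 0"
proof -
  let ?p = "monom 1 k - 1 :: 'a poly"
  have "coeff ?p k = 1" using assms by simp
  then have "?p \<noteq> 0" by (metis coeff_0 zero_neq_one)
  then have "card {t. poly ?p t = 0} \<le> degree ?p" by (rule card_poly_roots_bound)
  also have "\<dots> \<le> k" by (intro degree_diff_le) (auto simp: degree_monom_le)
  also have "\<dots> < card (UNIV - {0 :: 'a})" using assms by (simp add: card_Diff_singleton)
  finally have "\<not> UNIV - {0 :: 'a} \<subseteq> {t. poly ?p t = 0}"
    using card_mono[of "{t. poly ?p t = 0}" "UNIV - {0}"] by force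
  then obtain s :: 'a where s: "s \<noteq> 0" "s ^ k \<noteq> 1" by (auto simp: poly_monom)
  have "(\<Sum>t\<in>UNIV - {0 :: 'a}. t ^ k) = (\<Sum>t\<in>UNIV - {0}. (s * t) ^ k)"
    by (rule sum.reindex_bij_witness[of _ "\<lambda>t. s * t" "\<lambda>t. t / s"]) (use s in auto)
  also have "\<dots> = s ^ k * (\<Sum>t\<in>UNIV - {0}. t ^ k)"
    by (simp add: power_mult_distrib sum_distrib_left)
  finally show ?thesis using s by simp
qed

text \<open>Orthogonality of the characters \<open>t^k\<close> of the multiplicative group. The
  diagonal value is \<open>q - 1\<close>, which equals -1 in the field.\<close>

lemma sum_units_orthogonal:
  assumes "k < CARD('a::{field,finite}) - 1" "l < CARD('a) - 1"
  shows "(\<Sum>t\<in>UNIV - {0 :: 'a}. t ^ k * inverse t ^ l) = (if k = l then -1 else 0)"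
proof -
  consider "k = l" | "k < l" | "l < k" by linarith
  then show ?thesis
  proof cases
    case 1
    then have "(\<Sum>t\<in>UNIV - {0 :: 'a}. t ^ k * inverse t ^ l) = (\<Sum>t\<in>UNIV - {0 :: 'a}. 1)"
      by (intro sum.cong) (auto simp flip: power_mult_distrib)
    then show ?thesis
      using 1 of_nat_CARD_minus_1[where 'a = 'a] by (simp add: card_Diff_singleton)
  next
    case 2
    then have "t ^ k * inverse t ^ l = inverse t ^ (l - k)" if "t \<noteq> 0" for t :: 'a
      using that by (simp add: power_diff field_simps)
    then have "(\<Sum>t\<in>UNIV - {0 :: 'a}. t ^ k * inverse t ^ l) = (\<Sum>t\<in>UNIV - {0}. inverse t ^ (l - k))"
      by (intro sum.cong) auto
    also have "\<dots> = (\<Sum>t\<in>UNIV - {0 :: 'a}. t ^ (l - k))"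
      by (rule sum.reindex_bij_witness[of _ inverse inverse]) auto
    finally show ?thesis using 2 assms sum_power_units_eq_0[of "l - k", where 'a = 'a] by simp
  next
    case 3
    then have "t ^ k * inverse t ^ l = t ^ (k - l)" if "t \<noteq> 0" for t :: 'a
      using that by (simp add: power_diff field_simps)
    then have "(\<Sum>t\<in>UNIV - {0 :: 'a}. t ^ k * inverse t ^ l) = (\<Sum>t\<in>UNIV - {0}. t ^ (k - l))"
      by (intro sum.cong) auto
    then show ?thesis using 3 assms sum_power_units_eq_0[of "k - l", where 'a = 'a] by simp
  qed
qed

lemma sum_prod_torus:
  fixes h :: "'n::finite \<Rightarrow> 'a::{field,finite} \<Rightarrow> 'a"
  shows "(\<Sum>\<xi>\<in>torus. \<Prod>i\<in>UNIV. h i (\<xi> $ i)) = (\<Prod>i\<in>UNIV. \<Sum>t\<in>UNIV - {0}. h i t)"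
proof -
  have "(\<Prod>i\<in>UNIV. \<Sum>t\<in>UNIV - {0}. h i t) =
      (\<Sum>p\<in>PiE UNIV (\<lambda>_. UNIV - {0}). \<Prod>i\<in>UNIV. h i (p i))"
    by (intro prod_sum_PiE) auto
  also have "\<dots> = (\<Sum>\<xi>\<in>torus. \<Prod>i\<in>UNIV. h i (\<xi> $ i))"
    by (rule sum.reindex_bij_witness[of _ "vec_nth" "vec_lambda"]) (auto simp: torus_def PiE_iff)
  finally show ?thesis ..
qed

text \<open>Orthogonality recovers coefficients from values: summing \<open>f\<close> against the
  inverse of a monomial \<open>l\<close> over the torus gives the coefficient of \<open>l\<close> up
  to sign. The cube keeps all exponents below \<open>q - 1\<close>, where distinct exponents give
  distinct characters.\<close>

lemma mpoly_eval_nonzero_on_torus: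
  fixes f :: "('a::{field,finite}, 'n::finite) mpoly"
  assumes "f \<noteq> 0" and keys: "\<forall>m\<in>Poly_Mapping.keys f. exponent m \<in> K_cube CARD('a)"
  shows "\<exists>\<xi>\<in>torus. mpoly_eval f \<xi> \<noteq> 0"
proof (rule ccontr)
  assume "\<not> ?thesis"
  then have zero: "mpoly_eval f \<xi> = 0" if "\<xi> \<in> torus" for \<xi> using that by blast
  obtain l where l: "l \<in> Poly_Mapping.keys f" using \<open>f \<noteq> 0\<close> keys_eq_empty by blast
  have bound: "Poly_Mapping.lookup m i < CARD('a) - 1" if "m \<in> Poly_Mapping.keys f" for m i
  proof -
    have "real (Poly_Mapping.lookup m i) \<le> real CARD('a) - 2"
      using keys that by (auto simp: K_cube_def)
    then show ?thesis by linarith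
  qed
  let ?c = "\<lambda>\<xi> :: 'a ^ 'n. \<Prod>i\<in>UNIV. inverse (\<xi> $ i) ^ Poly_Mapping.lookup l i"
  have orth: "(\<Sum>\<xi>\<in>torus. monom_eval m \<xi> * ?c \<xi>) = (if m = l then (-1) ^ CARD('n) else 0)"
    if "m \<in> Poly_Mapping.keys f" for m
  proof -
    have "(\<Sum>\<xi>\<in>torus. monom_eval m \<xi> * ?c \<xi>) =
        (\<Sum>\<xi>\<in>torus. \<Prod>i\<in>UNIV. (\<xi> $ i) ^ Poly_Mapping.lookup m i
                                  * inverse (\<xi> $ i) ^ Poly_Mapping.lookup l i)"
      by (simp add: monom_eval_def prod.distrib)
    also have "\<dots> = (\<Prod>i\<in>UNIV. \<Sum>t\<in>UNIV - {0 :: 'a}. t ^ Poly_Mapping.lookup m i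
                                  * inverse t ^ Poly_Mapping.lookup l i)"
      by (rule sum_prod_torus[where h = "\<lambda>i t. t ^ Poly_Mapping.lookup m i * inverse t ^ Poly_Mapping.lookup l i"])
    also have "\<dots> = (\<Prod>i\<in>(UNIV :: 'n set). if Poly_Mapping.lookup m i = Poly_Mapping.lookup l i then -1 else 0)"
      by (intro prod.cong refl sum_units_orthogonal bound that l)
    also have "\<dots> = (if m = l then (-1) ^ CARD('n) else 0)"
    proof (cases "m = l")
      case False
      then obtain i where "Poly_Mapping.lookup m i \<noteq> Poly_Mapping.lookup l i"
        by (meson poly_mapping_eqI)
      then show ?thesis using False by (auto intro!: prod_zero)
    qed simp
    finally show ?thesis .
  qed
  have "0 = (\<Sum>\<xi>\<in>torus. mpoly_eval f \<xi> * ?c \<xi>)"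
    by (simp add: zero)
  also have "\<dots> = (\<Sum>m\<in>Poly_Mapping.keys f. Poly_Mapping.lookup f m * (\<Sum>\<xi>\<in>torus. monom_eval m \<xi> * ?c \<xi>))"
    unfolding mpoly_eval_def monom_eval_def sum_distrib_left sum_distrib_right
    by (subst sum.swap) (simp add: mult_ac)
  also have "\<dots> = (\<Sum>m\<in>Poly_Mapping.keys f. if m = l then Poly_Mapping.lookup f m * (-1) ^ CARD('n) else 0)"
    by (intro sum.cong) (auto simp: orth)
  also have "\<dots> = Poly_Mapping.lookup f l * (-1) ^ CARD('n)"
    using l by simp
  finally show False using l by (simp add: in_keys_iff)
qed


section \<open>Multiplication by binomials\<close>

text \<open>Greedy choice: remove a heaviest remaining element \<open>j\<close> times. The bound
  says that the rest weighs at most the fraction \<open>(card A - j) / card A\<close> of the total,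
  with denominators cleared.\<close>

lemma heaviest_subset:
  fixes w :: "'b \<Rightarrow> nat"
  assumes "finite A" "j \<le> card A"
  shows "\<exists>S\<subseteq>A. card S = j \<and> card A * sum w (A - S) \<le> (card A - j) * sum w A"
  using assms(2)
proof (induction j)
  case 0
  then show ?case by (intro exI[of _ "{}"]) auto
next
  case (Suc j)
  then obtain S where S: "S \<subseteq> A" "card S = j"
      "card A * sum w (A - S) \<le> (card A - j) * sum w A" by auto
  have fS: "finite S" using S assms finite_subset by blast
  have cardR: "card (A - S) = card A - j" using S fS by (simp add: card_Diff_subset)
  then have "A - S \<noteq> {}" using Suc.prems by force
  then have "Max (w ` (A - S)) \<in> w ` (A - S)" using assms by (intro Max_in) auto
  then obtain x where x: "x \<in> A - S" "w x = Max (w ` (A - S))" by auto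
  have "sum w (A - S) \<le> card (A - S) * w x"
    using sum_bounded_above[of "A - S" w "w x"] x assms by auto
  then have le: "sum w (A - S) \<le> (card A - j) * w x" by (simp add: cardR)
  have split: "sum w (A - S) = w x + sum w (A - insert x S)"
    using x assms by (metis Diff_insert finite_Diff sum.remove)
  obtain d where d: "card A - j = Suc d" using Suc.prems by (metis Suc_diff_Suc Suc_le_lessD)
  \<comment> \<open>Of \<open>Suc d\<close> remaining elements the heaviest weighs at least the
    mean, so without it at most the fraction \<open>d / Suc d\<close> is left.\<close>
  have "Suc d * sum w (A - insert x S) \<le> d * sum w (A - S)"
    using le split d by (simp add: algebra_simps)
  then have "card A * (Suc d * sum w (A - insert x S)) \<le> card A * (d * sum w (A - S))"
    by (rule mult_le_mono2)
  also have "\<dots> \<le> d * (Suc d * sum w A)"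
    using S(3) d by (metis mult.left_commute mult_le_mono2)
  finally have "Suc d * (card A * sum w (A - insert x S)) \<le> Suc d * (d * sum w A)"
    by (simp only: mult.left_commute)
  then have "card A * sum w (A - insert x S) \<le> d * sum w A"
    by (simp only: Suc_mult_le_cancel1)
  moreover have "card A - Suc j = d" using d by simp
  ultimately show ?case
    using x S fS by (intro exI[of _ "insert x S"]) auto
qed

text \<open>By convexity, \<open>j u + k v\<close> is \<open>j + k\<close> times a weighted mean of
  \<open>u\<close> and \<open>v\<close>. The case \<open>j + k = 0\<close> is separate because the
  weights divide by \<open>j + k\<close>.\<close>

lemma dilate_add_mem:
  assumes "convex Q" "x \<in> dilate j Q" "y \<in> dilate k Q"
  shows "x + y \<in> dilate (j + k) Q"
proof (cases "j + k = 0")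
  case True
  then show ?thesis using assms by (auto simp: dilate_def)
next
  case False
  obtain u v where u: "u \<in> Q" "x = real j *\<^sub>R u" and v: "v \<in> Q" "y = real k *\<^sub>R v"
    using assms by (auto simp: dilate_def)
  let ?z = "(j / (j + k)) *\<^sub>R u + (k / (j + k)) *\<^sub>R v"
  have "?z \<in> Q"
    using False assms(1) u v by (intro convexD) (auto simp flip: add_divide_distrib)
  moreover have "x + y = real (j + k) *\<^sub>R ?z"
    using False u v by (simp add: scaleR_add_right del: of_nat_add)
  ultimately show ?thesis by (auto simp: dilate_def)
qed

text \<open>Each factor \<open>x^a - c x^b\<close> has its support in \<open>Q\<close>, so it costs
  one unit of dilation. It preserves nonvanishing as a polynomial because \<open>c\<close> is
  nonzero.\<close>

lemma binomial_product:
  fixes g :: "('a::field, 'n::finite) mpoly"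
  assumes "convex Q" "exponent a \<in> Q" "exponent b \<in> Q" "a \<noteq> b"
    and "finite S" "0 \<notin> S" and "g \<noteq> 0" "g \<in> L_space (dilate k Q)"
  shows "\<exists>h. h \<noteq> 0 \<and> h \<in> L_space (dilate (card S + k) Q) \<and>
    (\<forall>\<xi>. mpoly_eval h \<xi> = (\<Prod>c\<in>S. monom_eval a \<xi> - c * monom_eval b \<xi>) * mpoly_eval g \<xi>)"
  using assms(5,6)
proof (induction S rule: finite_induct)
  case empty
  then show ?case using assms by auto
next
  case (insert c S)
  then obtain h where h: "h \<noteq> 0" "h \<in> L_space (dilate (card S + k) Q)"
    "\<And>\<xi>. mpoly_eval h \<xi> = (\<Prod>c\<in>S. monom_eval a \<xi> - c * monom_eval b \<xi>) * mpoly_eval g \<xi>"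
    by auto
  let ?b = "Poly_Mapping.single a 1 - Poly_Mapping.single b c"
  have dil: "exponent a \<in> dilate 1 Q" "exponent b \<in> dilate 1 Q"
    using assms by (auto simp: dilate_def)
  have "exponent m \<in> dilate (card (insert c S) + k) Q" if mem: "m \<in> Poly_Mapping.keys (?b * h)" for m
  proof -
    obtain u v where uv: "m = u + v" "u \<in> Poly_Mapping.keys ?b" "v \<in> Poly_Mapping.keys h"
      using mem keys_mult[of ?b h] by blast
    have "u = a \<or> u = b"
      using uv(2) by (auto simp: in_keys_iff lookup_minus lookup_single when_def split: if_splits)
    then have "exponent u \<in> dilate 1 Q" using dil by auto
    moreover have "exponent v \<in> dilate (card S + k) Q"
      using h(2) uv(3) by (auto simp: mem_L_space_iff)
    ultimately have "exponent u + exponent v \<in> dilate (1 + (card S + k)) Q"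
      by (rule dilate_add_mem[OF assms(1)])
    then show ?thesis using insert.hyps uv(1) by (simp add: exponent_add)
  qed
  then have "?b * h \<in> L_space (dilate (card (insert c S) + k) Q)" by (simp add: mem_L_space_iff)
  moreover have "?b * h \<noteq> 0"
    using h(1) assms(4) insert.prems by (intro binomial_mult_nonzero) auto
  moreover have "mpoly_eval (?b * h) \<xi> =
      (\<Prod>c\<in>insert c S. monom_eval a \<xi> - c * monom_eval b \<xi>) * mpoly_eval g \<xi>" for \<xi>
    using insert.hyps
    by (simp add: left_diff_distrib mpoly_eval_diff mpoly_eval_single_mult h(3))
  ultimately show ?case by blast
qed

text \<open>Trades \<open>j\<close> units of dilation for the factor
  \<open>(q - 1 - j) / (q - 1)\<close> in the weight, where \<open>q\<close> is the size of the
  field. Here \<open>h\<close> is nonzero only as a polynomial; that it also gives a nonzero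
  codeword depends on the cube.\<close>

lemma lighter_in_larger_dilate:
  fixes g :: "('a::{field,finite}, 'n::finite) mpoly"
  assumes "convex Q" "exponent a \<in> Q" "exponent b \<in> Q" "a \<noteq> b"
    and "j < CARD('a)" and "g \<noteq> 0" "g \<in> L_space (dilate k Q)"
  shows "\<exists>h :: ('a, 'n) mpoly. h \<noteq> 0 \<and> h \<in> L_space (dilate (j + k) Q) \<and>
    (CARD('a) - 1) * hamming_weight torus (mpoly_eval h)
      \<le> (CARD('a) - 1 - j) * hamming_weight torus (mpoly_eval g)"
proof -
  let ?U = "UNIV - {0 :: 'a}"
  define r where "r \<xi> = monom_eval a \<xi> / monom_eval b \<xi>" for \<xi> :: "'a ^ 'n"
  define cls where "cls c = {\<xi> \<in> torus. mpoly_eval g \<xi> \<noteq> 0 \<and> r \<xi> = c}" for c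
  have cardU: "card ?U = CARD('a) - 1" by (simp add: card_Diff_singleton)
  have union: "card (\<Union>c\<in>B. cls c) = (\<Sum>c\<in>B. card (cls c))" if "B \<subseteq> ?U" for B
    by (intro card_UN_disjoint) (auto simp: cls_def)
  obtain S where S: "S \<subseteq> ?U" "card S = j"
    and le: "card ?U * (\<Sum>c\<in>?U - S. card (cls c)) \<le> (card ?U - j) * (\<Sum>c\<in>?U. card (cls c))"
    using heaviest_subset[of ?U j "\<lambda>c. card (cls c)"] assms(5) unfolding cardU by force
  have S0: "finite S" "0 \<notin> S" using S(1) by auto
  obtain h where h: "h \<noteq> 0" "h \<in> L_space (dilate (card S + k) Q)"
    "\<And>\<xi>. mpoly_eval h \<xi> = (\<Prod>c\<in>S. monom_eval a \<xi> - c * monom_eval b \<xi>) * mpoly_eval g \<xi>"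
    using binomial_product[OF assms(1-4) S0 assms(6,7)] by blast
  have rU: "r \<xi> \<noteq> 0" if "\<xi> \<in> torus" for \<xi>
    using monom_eval_nonzero[OF that] by (simp add: r_def)
  have "{\<xi> \<in> torus. mpoly_eval g \<xi> \<noteq> 0} = (\<Union>c\<in>?U. cls c)"
    using rU by (auto simp: cls_def)
  then have wg: "hamming_weight torus (mpoly_eval g) = (\<Sum>c\<in>?U. card (cls c))"
    by (simp add: hamming_weight_def union)
  \<comment> \<open>Monomials do not vanish on the torus, so the factor for \<open>c\<close>
    vanishes exactly where the ratio \<open>r\<close> equals \<open>c\<close>: multiplication
    deletes precisely the classes in \<open>S\<close>.\<close>
  have "mpoly_eval h \<xi> \<noteq> 0 \<longleftrightarrow> mpoly_eval g \<xi> \<noteq> 0 \<and> r \<xi> \<notin> S" if "\<xi> \<in> torus" for \<xi>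
    using monom_eval_nonzero[OF that, of b] by (auto simp: h(3) r_def field_simps)
  then have "{\<xi> \<in> torus. mpoly_eval h \<xi> \<noteq> 0} = (\<Union>c\<in>?U - S. cls c)"
    using rU by (auto simp: cls_def)
  then have wh: "hamming_weight torus (mpoly_eval h) = (\<Sum>c\<in>?U - S. card (cls c))"
    by (simp add: hamming_weight_def union)
  show ?thesis
    using h(1,2) S(2) le unfolding wg[symmetric] wh[symmetric] cardU by blast
qed


section \<open>Adding a variable\<close>

definition extend_exp :: "('n::finite \<Rightarrow>\<^sub>0 nat) \<Rightarrow> nat \<Rightarrow> ('n option \<Rightarrow>\<^sub>0 nat)" where
  "extend_exp m j = Abs_poly_mapping (case_option j (Poly_Mapping.lookup m))"

definition restrict_exp :: "('n::finite option \<Rightarrow>\<^sub>0 nat) \<Rightarrow> ('n \<Rightarrow>\<^sub>0 nat)" where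
  "restrict_exp m = Abs_poly_mapping (\<lambda>i. Poly_Mapping.lookup m (Some i))"

definition extend_vec :: "'a ^ 'n \<Rightarrow> 'a \<Rightarrow> 'a ^ ('n::finite option)" where
  "extend_vec x y = (\<chi> i. case_option y (($) x) i)"

text \<open>The coefficient of \<open>y^j\<close>, where \<open>y\<close> is the variable indexed by
  \<open>None\<close>.\<close>

definition slice :: "nat \<Rightarrow> ('a::field, 'n::finite option) mpoly \<Rightarrow> ('a, 'n) mpoly" where
  "slice j f = Poly_Mapping.map_key (\<lambda>m. extend_exp m j) f"

lemma lookup_extend_exp [simp]:
  "Poly_Mapping.lookup (extend_exp m j) None = j"
  "Poly_Mapping.lookup (extend_exp m j) (Some i) = Poly_Mapping.lookup m i"
  by (simp_all add: extend_exp_def)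

lemma lookup_restrict_exp [simp]:
  "Poly_Mapping.lookup (restrict_exp m) i = Poly_Mapping.lookup m (Some i)"
  by (simp add: restrict_exp_def)

lemma restrict_extend_exp [simp]: "restrict_exp (extend_exp m j) = m"
  by (rule poly_mapping_eqI) simp

lemma extend_restrict_exp: "extend_exp (restrict_exp m) (Poly_Mapping.lookup m None) = m"
  by (rule poly_mapping_eqI) (metis lookup_extend_exp lookup_restrict_exp not_None_eq)

lemma extend_vec_nth [simp]:
  "extend_vec x y $ None = y" "extend_vec x y $ Some i = x $ i"
  by (simp_all add: extend_vec_def)

lemma lookup_slice [simp]:
  fixes f :: "('a::field, 'n::finite option) mpoly"
  shows "Poly_Mapping.lookup (slice j f) m = Poly_Mapping.lookup f (extend_exp m j)"
proof -
  have "inj (\<lambda>m :: 'n \<Rightarrow>\<^sub>0 nat. extend_exp m j)"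
    by (rule injI) (metis restrict_extend_exp)
  then show ?thesis by (simp add: slice_def map_key.rep_eq)
qed

lemma prod_UNIV_option: "(\<Prod>i\<in>UNIV. h i) = h None * (\<Prod>i\<in>UNIV. h (Some i))"
  for h :: "'n::finite option \<Rightarrow> 'a::comm_monoid_mult"
  by (simp add: UNIV_option_conv prod.reindex)

lemma monom_eval_extend:
  "monom_eval (extend_exp m j) (extend_vec \<xi> y) = monom_eval m \<xi> * y ^ j"
  by (simp add: monom_eval_def prod_UNIV_option mult.commute)

lemma mpoly_eval_slices:
  fixes f :: "('a::field, 'n::finite option) mpoly"
  assumes "\<forall>m\<in>Poly_Mapping.keys f. Poly_Mapping.lookup m None \<le> k"
  shows "mpoly_eval f (extend_vec \<xi> y) = (\<Sum>j\<le>k. mpoly_eval (slice j f) \<xi> * y ^ j)"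
proof -
  \<comment> \<open>One index set containing the supports of all slices, so that the double sum runs
    over a rectangle; the pairs that are not exponents of \<open>f\<close> contribute zero.\<close>
  let ?M = "restrict_exp ` Poly_Mapping.keys f"
  let ?\<phi> = "\<lambda>(j, m). extend_exp m j"
  let ?\<xi> = "extend_vec \<xi> y"
  have sub: "Poly_Mapping.keys (slice j f) \<subseteq> ?M" for j
    by (force simp: in_keys_iff intro: rev_image_eqI)
  have inj: "inj_on ?\<phi> ({..k} \<times> ?M)"
    by (auto intro!: inj_onI) (metis lookup_extend_exp(1), metis restrict_extend_exp)
  have "Poly_Mapping.keys f \<subseteq> ?\<phi> ` ({..k} \<times> ?M)"
  proof
    fix m assume "m \<in> Poly_Mapping.keys f"
    then show "m \<in> ?\<phi> ` ({..k} \<times> ?M)"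
      using assms extend_restrict_exp[of m]
      by (intro image_eqI[of _ _ "(Poly_Mapping.lookup m None, restrict_exp m)"]) auto
  qed
  then have "mpoly_eval f ?\<xi> = (\<Sum>m\<in>?\<phi> ` ({..k} \<times> ?M). Poly_Mapping.lookup f m * monom_eval m ?\<xi>)"
    by (intro mpoly_eval_superset) auto
  also have "\<dots> = (\<Sum>(j, m)\<in>{..k} \<times> ?M.
      Poly_Mapping.lookup (slice j f) m * monom_eval m \<xi> * y ^ j)"
    by (subst sum.reindex[OF inj])
       (auto simp: monom_eval_extend mult.assoc intro!: sum.cong)
  also have "\<dots> = (\<Sum>j\<le>k. mpoly_eval (slice j f) \<xi> * y ^ j)"
    by (simp add: sum.cartesian_product[symmetric] mpoly_eval_superset[OF _ sub] sum_distrib_right)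
  finally show ?thesis .
qed

text \<open>Counts the support fibre by fibre over the projection that forgets the last
  coordinate.\<close>

lemma hamming_weight_extend:
  fixes F :: "'a::{field,finite} ^ ('n::finite option) \<Rightarrow> 'a"
  shows "hamming_weight torus F =
    (\<Sum>\<xi>\<in>torus. card {y. y \<noteq> 0 \<and> F (extend_vec \<xi> y) \<noteq> 0})"
proof -
  let ?B = "SIGMA \<xi>:torus. {y. y \<noteq> 0 \<and> F (extend_vec \<xi> y) \<noteq> 0}"
  have "bij_betw (\<lambda>(\<xi>, y). extend_vec \<xi> y) ?B {\<xi> \<in> torus. F \<xi> \<noteq> 0}"
  proof (rule bij_betw_byWitness[where f' = "\<lambda>z. ((\<chi> i. z $ Some i), z $ None)"])
    have ext: "extend_vec (\<chi> i. z $ Some i) (z $ None) = z" for z :: "'a ^ ('n option)"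
      by (simp add: vec_eq_iff split_option_all)
    then show "\<forall>z\<in>{\<xi> \<in> torus. F \<xi> \<noteq> 0}.
        (\<lambda>(\<xi>, y). extend_vec \<xi> y) ((\<chi> i. z $ Some i), z $ None) = z" by simp
    show "(\<lambda>z. ((\<chi> i. z $ Some i), z $ None)) ` {\<xi> \<in> torus. F \<xi> \<noteq> 0} \<subseteq> ?B"
      using ext by (auto simp: torus_def)
    show "(\<lambda>(\<xi>, y). extend_vec \<xi> y) ` ?B \<subseteq> {\<xi> \<in> torus. F \<xi> \<noteq> 0}"
      by (auto simp: torus_def extend_vec_def split: option.splits)
  qed (auto simp: vec_eq_iff)
  then have "card {\<xi> \<in> torus. F \<xi> \<noteq> 0} = card ?B"
    by (simp add: bij_betw_same_card)
  also have "\<dots> = (\<Sum>\<xi>\<in>torus. card {y. y \<noteq> 0 \<and> F (extend_vec \<xi> y) \<noteq> 0})"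
    by (intro card_SigmaI) auto
  finally show ?thesis by (simp add: hamming_weight_def)
qed

text \<open>Above a point where \<open>slice j f\<close> does not vanish, \<open>f\<close> is a
  polynomial in \<open>y\<close> of degree exactly \<open>j\<close>, so at most \<open>j\<close> of
  the \<open>q - 1\<close> units are roots, where \<open>q\<close> is the size of the field.\<close>

lemma hamming_weight_top_slice:
  fixes f :: "('a::{field,finite}, 'n::finite option) mpoly"
  assumes "\<forall>m\<in>Poly_Mapping.keys f. Poly_Mapping.lookup m None \<le> j"
  shows "(CARD('a) - 1 - j) * hamming_weight torus (mpoly_eval (slice j f))
           \<le> hamming_weight torus (mpoly_eval f)"
proof -
  have *: "CARD('a) - 1 - j \<le> card {y. y \<noteq> 0 \<and> mpoly_eval f (extend_vec \<xi> y) \<noteq> 0}"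
    if nz: "mpoly_eval (slice j f) \<xi> \<noteq> 0" for \<xi>
  proof -
    define p where "p = (\<Sum>i\<le>j. monom (mpoly_eval (slice i f) \<xi>) i)"
    have ev: "mpoly_eval f (extend_vec \<xi> y) = poly p y" for y
      by (simp add: mpoly_eval_slices[OF assms] p_def poly_sum poly_monom)
    have "coeff p j = mpoly_eval (slice j f) \<xi>"
      by (simp add: p_def coeff_sum)
    then have "p \<noteq> 0" using nz by auto
    then have "card {y. poly p y = 0} \<le> degree p" by (rule card_poly_roots_bound)
    also have "\<dots> \<le> j"
      unfolding p_def by (intro degree_sum_le) (auto intro: order_trans[OF degree_monom_le])
    finally have "card {y. poly p y = 0} \<le> j" .
    \<comment> \<open>The root count may include \<open>y = 0\<close>, which is not a unit; this
      only helps the lower bound.\<close>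
    moreover have "card (UNIV - {0 :: 'a}) - card {y. poly p y = 0}
        \<le> card ((UNIV - {0}) - {y. poly p y = 0})"
      by (intro diff_card_le_card_Diff) auto
    moreover have "(UNIV - {0}) - {y. poly p y = 0} = {y. y \<noteq> 0 \<and> mpoly_eval f (extend_vec \<xi> y) \<noteq> 0}"
      by (auto simp: ev)
    ultimately show ?thesis by (simp add: card_Diff_singleton)
  qed
  have "(CARD('a) - 1 - j) * hamming_weight torus (mpoly_eval (slice j f)) =
      (\<Sum>\<xi>\<in>{\<xi> \<in> torus. mpoly_eval (slice j f) \<xi> \<noteq> 0}. CARD('a) - 1 - j)"
    by (simp add: hamming_weight_def)
  also have "\<dots> \<le> (\<Sum>\<xi>\<in>{\<xi> \<in> torus. mpoly_eval (slice j f) \<xi> \<noteq> 0}.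
      card {y. y \<noteq> 0 \<and> mpoly_eval f (extend_vec \<xi> y) \<noteq> 0})"
    by (intro sum_mono *) auto
  also have "\<dots> \<le> (\<Sum>\<xi>\<in>torus. card {y. y \<noteq> 0 \<and> mpoly_eval f (extend_vec \<xi> y) \<noteq> 0})"
    by (intro sum_mono2) auto
  finally show ?thesis by (simp add: hamming_weight_extend)
qed


section \<open>The pyramid\<close>

lemma linear_embed0: "linear (embed0 :: real ^ 'n::finite \<Rightarrow> _)"
  by (rule linearI) (auto simp: embed0_def vec_eq_iff split: option.splits)

text \<open>The section of the dilated pyramid at height \<open>j\<close> is
  \<open>(k - j)Q\<close>: a point \<open>k(u e + v x)\<close> with apex \<open>e\<close> and
  \<open>u + v = 1\<close> has height \<open>k u\<close>, and its base part is scaled by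
  \<open>k v = k - k u\<close>.\<close>

lemma mem_dilate_unit_pyramid:
  assumes "convex Q" "Q \<noteq> {}" "exponent m \<in> dilate k (unit_pyramid Q)"
  shows "Poly_Mapping.lookup m None \<le> k"
    and "exponent (restrict_exp m) \<in> dilate (k - Poly_Mapping.lookup m None) Q"
proof -
  \<comment> \<open>The base is already convex, so the pyramid consists of the segments from the
    apex to points of the base.\<close>
  have hull: "convex hull (embed0 ` Q) = embed0 ` Q"
    using assms(1) linear_embed0 convex_linear_image by (metis convex_hull_eq)
  obtain u v x where uv: "0 \<le> u" "0 \<le> v" "u + v = 1" "x \<in> Q"
    and eq: "exponent m = real k *\<^sub>R (u *\<^sub>R axis None 1 + v *\<^sub>R embed0 x)"
    using assms(3) unfolding dilate_def unit_pyramid_def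
    by (subst (asm) convex_hull_insert) (use assms(2) in \<open>auto simp: hull\<close>)
  have top: "real (Poly_Mapping.lookup m None) = k * u"
    using arg_cong[OF eq, of "\<lambda>z. z $ None"] by (simp add: embed0_def axis_def)
  have some: "real (Poly_Mapping.lookup m (Some i)) = k * v * x $ i" for i
    using arg_cong[OF eq, of "\<lambda>z. z $ Some i"] by (simp add: embed0_def axis_def)
  have "real k * u \<le> real k * 1" using uv by (intro mult_left_mono) auto
  then show le: "Poly_Mapping.lookup m None \<le> k" using top by simp
  have "real (k - Poly_Mapping.lookup m None) = k * v"
    using le top uv by (simp add: of_nat_diff) (metis add_diff_cancel_left' mult.right_neutral right_diff_distrib)
  then have "exponent (restrict_exp m) = real (k - Poly_Mapping.lookup m None) *\<^sub>R x"
    by (simp add: vec_eq_iff some)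
  then show "exponent (restrict_exp m) \<in> dilate (k - Poly_Mapping.lookup m None) Q"
    using uv by (auto simp: dilate_def)
qed

text \<open>Reads \<open>f\<close> as a polynomial not involving \<open>y\<close>: its exponents
  move to height 0, inside the dilated base.\<close>

lemma exists_extended_codeword:
  fixes f :: "('a::{field,finite}, 'n::finite) mpoly"
  assumes "f \<in> L_space (dilate k Q)"
  obtains F where "F \<in> L_space (dilate k (unit_pyramid Q))"
    and "\<And>\<xi> y. mpoly_eval F (extend_vec \<xi> y) = mpoly_eval f \<xi>"
proof -
  define F where "F = (\<Sum>m\<in>Poly_Mapping.keys f.
    Poly_Mapping.single (extend_exp m 0) (Poly_Mapping.lookup f m))"
  have keys: "Poly_Mapping.keys F \<subseteq> (\<lambda>m. extend_exp m 0) ` Poly_Mapping.keys f"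
    unfolding F_def by (rule order_trans[OF keys_sum]) (auto split: if_splits)
  have inj: "extend_exp m 0 = extend_exp m' 0 \<longleftrightarrow> m = m'" for m m' :: "'n \<Rightarrow>\<^sub>0 nat"
    by (metis restrict_extend_exp)
  have "slice 0 F = f"
    by (rule poly_mapping_eqI)
       (simp add: F_def lookup_sum lookup_single when_def inj in_keys_iff)
  then have "mpoly_eval F (extend_vec \<xi> y) = mpoly_eval f \<xi>" for \<xi> y
    using keys by (subst mpoly_eval_slices[where k = 0]) auto
  moreover have "F \<in> L_space (dilate k (unit_pyramid Q))"
    unfolding mem_L_space_iff
  proof
    fix m assume "m \<in> Poly_Mapping.keys F"
    then obtain l where l: "l \<in> Poly_Mapping.keys f" "m = extend_exp l 0" using keys by auto
    then obtain x where x: "x \<in> Q" "exponent l = real k *\<^sub>R x"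
      using assms by (auto simp: mem_L_space_iff dilate_def)
    have "exponent m = real k *\<^sub>R embed0 x"
      using x(2) by (auto simp: l(2) vec_eq_iff embed0_def split: option.splits)
    moreover have "embed0 x \<in> unit_pyramid Q"
      unfolding unit_pyramid_def using x(1) by (intro hull_inc) auto
    ultimately show "exponent m \<in> dilate k (unit_pyramid Q)"
      by (auto simp: dilate_def)
  qed
  ultimately show ?thesis using that by blast
qed

section \<open>Minimum distances as minima of weights of polynomials, and their comparison\<close>

lemma toric_min_distance_eq:
  "toric_min_distance TYPE('a::{field,finite}) P =
     Min {hamming_weight torus (mpoly_eval f) | f :: ('a, 'n::finite) mpoly.
            f \<in> L_space P \<and> (\<exists>\<xi>\<in>torus. mpoly_eval f \<xi> \<noteq> 0)}"
proof -
  have eq: "hamming_weight torus (restrict c torus) = hamming_weight torus c" for c :: "'a ^ 'n \<Rightarrow> 'a"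
    unfolding hamming_weight_def by (rule arg_cong[where f = card]) auto
  have "{hamming_weight torus c | c :: 'a ^ 'n \<Rightarrow> 'a. c \<in> toric_code P \<and> (\<exists>\<xi>\<in>torus. c \<xi> \<noteq> 0)} =
      {hamming_weight torus (mpoly_eval f) | f :: ('a, 'n) mpoly.
         f \<in> L_space P \<and> (\<exists>\<xi>\<in>torus. mpoly_eval f \<xi> \<noteq> 0)}" (is "?A = ?B")
  proof (intro equalityI subsetI)
    fix w assume "w \<in> ?A"
    then obtain f :: "('a, 'n) mpoly" where "f \<in> L_space P" "w = hamming_weight torus (mpoly_eval f)"
      "\<exists>\<xi>\<in>torus. restrict (mpoly_eval f) torus \<xi> \<noteq> 0"
      using eq unfolding toric_code_def by blast
    then show "w \<in> ?B" by auto
  next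
    fix w assume "w \<in> ?B"
    then obtain f :: "('a, 'n) mpoly" where f: "f \<in> L_space P"
      "w = hamming_weight torus (restrict (mpoly_eval f) torus)"
      "\<exists>\<xi>\<in>torus. restrict (mpoly_eval f) torus \<xi> \<noteq> 0"
      by (auto simp: eq)
    then have "restrict (mpoly_eval f) torus \<in> toric_code P" by (auto simp: toric_code_def)
    with f show "w \<in> ?A" by blast
  qed
  then show ?thesis
    unfolding toric_min_distance_def min_distance_def by (rule arg_cong)
qed

lemma hamming_weight_le: "finite I \<Longrightarrow> hamming_weight I c \<le> card I"
  unfolding hamming_weight_def by (intro card_mono) auto

theorem theorem2p4:
  fixes Q :: "(real ^ 'n) set" and q N :: nat
  assumes "CARD('a::{field,finite}) = q"
    and "N < q - 1"
    and "lattice_polytope Q"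
    and "aff_dim Q \<ge> 1"
    and "\<forall>k\<le>N. dilate k Q \<subseteq> K_cube q"
  shows "\<forall>k\<le>N. toric_min_distance TYPE('a) (dilate k (unit_pyramid Q)) =
           (q - 1) * toric_min_distance TYPE('a) (dilate k Q)"
proof (intro allI impI)
  fix k assume k: "k \<le> N"
  obtain S where S: "finite S" "S \<noteq> {}" "S \<subseteq> lattice" "Q = convex hull S"
    using assms(3) by (auto simp: lattice_polytope_def)
  have Q: "convex Q" "Q \<noteq> {}" "S \<subseteq> Q" using S by (auto simp: hull_subset)
  have cube: "dilate k Q \<subseteq> K_cube CARD('a)" using assms(1,5) k by simp
  define A where "A = {hamming_weight torus (mpoly_eval f) | f :: ('a, 'n option) mpoly.
    f \<in> L_space (dilate k (unit_pyramid Q)) \<and> (\<exists>\<xi>\<in>torus. mpoly_eval f \<xi> \<noteq> 0)}"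
  define B where "B = {hamming_weight torus (mpoly_eval f) | f :: ('a, 'n) mpoly.
    f \<in> L_space (dilate k Q) \<and> (\<exists>\<xi>\<in>torus. mpoly_eval f \<xi> \<noteq> 0)}"
  have finA: "finite A"
    by (rule finite_subset[of _ "{..card (torus :: ('a ^ 'n option) set)}"])
       (auto simp: A_def hamming_weight_le)
  have finB: "finite B"
    by (rule finite_subset[of _ "{..card (torus :: ('a ^ 'n) set)}"])
       (auto simp: B_def hamming_weight_le)

  \<comment> \<open>Needed for \<open>Min B\<close> to be attained. The witness is the monomial with
    exponent \<open>k x\<close> for a generator \<open>x\<close> of \<open>Q\<close>; the cube makes
    this exponent nonnegative, and the monomial takes the value 1 at the all-ones point.\<close>
  have "B \<noteq> {}"
  proof -
    obtain x where x: "x \<in> S" using S(2) by auto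
    have kx: "real k *\<^sub>R x \<in> dilate k Q" using x Q by (auto simp: dilate_def)
    then have "real k *\<^sub>R x \<in> K_cube CARD('a)" using cube by auto
    moreover have "real k *\<^sub>R x \<in> lattice" using x S(3) by (auto simp: lattice_def)
    ultimately obtain m where "exponent m = real k *\<^sub>R x"
      using exponent_surj[of "real k *\<^sub>R x"] by (auto simp: K_cube_def)
    then have "monomial m \<in> (L_space (dilate k Q) :: ('a, 'n) mpoly set)"
      using kx by (auto simp: mem_L_space_iff monomial_def)
    moreover have "\<exists>\<xi>\<in>torus. mpoly_eval (monomial m) \<xi> \<noteq> (0 :: 'a)"
      by (intro bexI[of _ "\<chi> i. 1"]) (auto simp: torus_def monomial_def mpoly_eval_def)
    ultimately show ?thesis unfolding B_def by blast
  qed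

  \<comment> \<open>A polynomial free of \<open>y\<close> is constant on each fibre, so every point
    of its support counts \<open>q - 1\<close> times.\<close>
  have BA: "(q - 1) * b \<in> A" if "b \<in> B" for b
  proof -
    obtain f :: "('a, 'n) mpoly" and \<xi> where f: "f \<in> L_space (dilate k Q)" "\<xi> \<in> torus"
      "mpoly_eval f \<xi> \<noteq> 0" "b = hamming_weight torus (mpoly_eval f)"
      using \<open>b \<in> B\<close> by (auto simp: B_def)
    obtain F where F: "F \<in> L_space (dilate k (unit_pyramid Q))"
      "\<And>\<xi> y. mpoly_eval F (extend_vec \<xi> y) = mpoly_eval f \<xi>"
      using exists_extended_codeword[OF f(1)] by blast
    have "{y :: 'a. y \<noteq> 0} = UNIV - {0}" by auto
    then have "card {y. y \<noteq> 0 \<and> mpoly_eval F (extend_vec \<zeta> y) \<noteq> 0} =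
        (if mpoly_eval f \<zeta> \<noteq> 0 then q - 1 else 0)" for \<zeta>
      using assms(1) by (simp add: F(2) card_Diff_singleton)
    then have "hamming_weight torus (mpoly_eval F) = (q - 1) * b"
      unfolding hamming_weight_extend[of "mpoly_eval F"] f(4)
      by (simp add: hamming_weight_def sum.If_cases Int_def)
    moreover have "extend_vec \<xi> 1 \<in> torus"
      using f(2) by (auto simp: torus_def extend_vec_def split: option.splits)
    then have "\<exists>\<xi>\<in>torus. mpoly_eval F \<xi> \<noteq> 0"
      using f(3) by (metis F(2))
    ultimately show ?thesis
      unfolding A_def using F(1) by force
  qed

  have AB: "\<exists>b\<in>B. (q - 1) * b \<le> a" if "a \<in> A" for a
  proof -
    obtain f :: "('a, 'n option) mpoly" where f: "f \<in> L_space (dilate k (unit_pyramid Q))"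
      "\<exists>\<xi>\<in>torus. mpoly_eval f \<xi> \<noteq> 0" "a = hamming_weight torus (mpoly_eval f)"
      using \<open>a \<in> A\<close> by (auto simp: A_def)
    let ?D = "(\<lambda>m. Poly_Mapping.lookup m None) ` Poly_Mapping.keys f"
    \<comment> \<open>The degree of \<open>f\<close> in \<open>y\<close>, so that
      \<open>slice j f\<close> is the leading coefficient.\<close>
    define j where "j = Max ?D"
    have "Poly_Mapping.keys f \<noteq> {}" using f(2) by (auto simp: mpoly_eval_def)
    then have "j \<in> ?D" unfolding j_def by (intro Max_in) auto
    then obtain m where m: "m \<in> Poly_Mapping.keys f" "Poly_Mapping.lookup m None = j" by auto
    have top: "\<forall>m\<in>Poly_Mapping.keys f. Poly_Mapping.lookup m None \<le> j"
      unfolding j_def by auto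
    have jk: "j \<le> k"
      using m f(1) mem_dilate_unit_pyramid(1)[OF Q(1,2)] by (auto simp: mem_L_space_iff)
    let ?g = "slice j f"
    have "Poly_Mapping.lookup ?g (restrict_exp m) \<noteq> 0"
      using m extend_restrict_exp[of m] by (simp add: in_keys_iff)
    then have g0: "?g \<noteq> 0" by (metis lookup_zero)
    have gL: "?g \<in> L_space (dilate (k - j) Q)"
      unfolding mem_L_space_iff
    proof
      fix l assume "l \<in> Poly_Mapping.keys ?g"
      then have "exponent (extend_exp l j) \<in> dilate k (unit_pyramid Q)"
        using f(1) by (simp add: mem_L_space_iff in_keys_iff)
      from mem_dilate_unit_pyramid(2)[OF Q(1,2) this]
      show "exponent l \<in> dilate (k - j) Q" by simp
    qed
    have "\<exists>h :: ('a, 'n) mpoly. h \<noteq> 0 \<and> h \<in> L_space (dilate k Q) \<and>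
      (q - 1) * hamming_weight torus (mpoly_eval h)
        \<le> (q - 1 - j) * hamming_weight torus (mpoly_eval ?g)"
    proof (cases "j = 0")
      case True
      then show ?thesis using g0 gL by (metis diff_zero order_refl)
    next
      case False
      \<comment> \<open>A single generator would make \<open>Q\<close> a point, against
        \<open>aff_dim Q \<ge> 1\<close>; hence two distinct lattice points are available.\<close>
      have "\<not> S \<subseteq> {x}" for x
      proof
        assume "S \<subseteq> {x}"
        then have "S = {x}" using S(2) by auto
        then show False using assms(4) S(4) by simp
      qed
      then obtain x y where xy: "x \<in> S" "y \<in> S" "x \<noteq> y" by blast
      \<comment> \<open>Here \<open>1 \<le> j \<le> k \<le> N\<close>, so \<open>Q\<close> itself
        lies in the cube and its lattice points are exponents of monomials. For \<open>N = 0\<close>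
        it could have negative coordinates, which is why \<open>j = 0\<close> is treated
        apart.\<close>
      have "dilate 1 Q \<subseteq> K_cube q" using assms(5) k jk False by (metis le_trans less_one not_le)
      then have "0 \<le> z $ i" if "z \<in> S" for z i
        using that Q(3) by (auto simp: dilate_def K_cube_def)
      then obtain u v where uv: "exponent u = x" "exponent v = y"
        using xy S(3) exponent_surj by (metis subsetD)
      have "u \<noteq> v" "exponent u \<in> Q" "exponent v \<in> Q" using uv xy Q(3) by auto
      moreover have "j < CARD('a)" using jk k assms(1,2) by simp
      ultimately show ?thesis
        using lighter_in_larger_dilate[OF Q(1), of u v j ?g "k - j"] g0 gL jk assms(1) by simp
    qed
    then obtain h :: "('a, 'n) mpoly" where h: "h \<noteq> 0" "h \<in> L_space (dilate k Q)"
      "(q - 1) * hamming_weight torus (mpoly_eval h)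
        \<le> (q - 1 - j) * hamming_weight torus (mpoly_eval ?g)" by blast
    \<comment> \<open>The return to \<open>kQ\<close>, which lies in the cube, turns the nonzero
      polynomial \<open>h\<close> into a nonzero codeword.\<close>
    have "\<exists>\<xi>\<in>torus. mpoly_eval h \<xi> \<noteq> 0"
      using h(1,2) cube by (intro mpoly_eval_nonzero_on_torus) (auto simp: mem_L_space_iff)
    then have "hamming_weight torus (mpoly_eval h) \<in> B" unfolding B_def using h(2) by blast
    moreover have "(q - 1) * hamming_weight torus (mpoly_eval h) \<le> a"
      using h(3) hamming_weight_top_slice[OF top] assms(1) f(3) by simp
    ultimately show ?thesis by blast
  qed

  \<comment> \<open>\<open>BA\<close> shows that the value is attained in \<open>A\<close>, and
    \<open>AB\<close> that it is a lower bound.\<close>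
  have "Min A = (q - 1) * Min B"
  proof (rule Min_eqI)
    show "finite A" by (rule finA)
    show "(q - 1) * Min B \<in> A" using BA Min_in[OF finB \<open>B \<noteq> {}\<close>] by blast
    fix a assume "a \<in> A"
    then obtain b where "b \<in> B" "(q - 1) * b \<le> a" using AB by blast
    then show "(q - 1) * Min B \<le> a"
      using Min_le[OF finB \<open>b \<in> B\<close>] by (meson le_trans mult_le_mono2)
  qed
  then show "toric_min_distance TYPE('a) (dilate k (unit_pyramid Q)) =
      (q - 1) * toric_min_distance TYPE('a) (dilate k Q)"
    unfolding toric_min_distance_eq A_def B_def .
qed

end
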